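(* Let $q$ be an odd prime power. Then the incidence structure $(\mathcal{L}_1,\mathcal{H}_1)$ is a generalized partial geometry of grade $3$, namely a $\mathrm{PG}(q-1,\,q(q^2-1)-1;\,q-2,q-1,q)$.
   Context: A line of $\mathrm{PG}(3,q)$ is represented by a $2\times4$ matrix of rank $2$ over $\mathbb{F}_q$ whose rows span it. Let $I_2$ be the $2\times 2$ identity matrix. Fix the line $(I_2\ \ 0)$. $\mathcal{L}_1$ is the set of all lines of $\mathrm{PG}(3,q)$ skew to $(I_2\ \ 0)$, i.e. $$\mathcal{L}_1=\{L_N=(N\ \ I_2): N\in\mathbb{F}_q^{2\times2}\}.$$ $\mathcal{H}_1$ is the set of all hyperbolic quadrics of $\mathrm{PG}(3,q)$ containing the line $(I_2\ \ 0)$; these are the quadrics with matrix $\begin{pmatrix} 0 & B \\ B^T & C \end{pmatrix}$, $B\in GL_2(\mathbb{F}_q)$, $C=C^T\in\mathbb{F}_q^{2\times2}$, where nonzero scalar multiples represent the same quadric. Viewed as a block, such a quadric is the set of lines of $\mathcal{L}_1$ contained in it: $$H_{B,C}=\Big\{L_N\in\mathcal{L}_1: L_N\begin{pmatrix} 0 & B \\ B^T & C \end{pmatrix}L_N^T=0\Big\}=\{L_N: B^TN^T+NB+C=0\}.$$ The "points" of the incidence structure $(\mathcal{L}_1,\mathcal{H}_1)$ are the lines in $\mathcal{L}_1$, the "blocks" are the elements of $\mathcal{H}_1$. A generalized partial geometry of grade $r$, denoted $\mathrm{PG}(s,t;\alpha_1,\dots,\alpha_r)$, is an incidence structure $(\mathcal{P},\mathcal{B})$,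 with $\mathcal{P}$ a finite non-empty set of points and $\mathcal{B}$ a family of subsets of $\mathcal{P}$ (blocks), incidence being containment, such that: (i) any two distinct points are incident with at most one common block; (ii) each block is incident with exactly $s+1$ points; (iii) each point is incident with exactly $t+1$ blocks; (iv) for any point $P$ and block $B$ with $P\notin B$, there is $\alpha\in\{\alpha_1,\dots,\alpha_r\}$ such that exactly $\alpha$ points of $B$ are joined to $P$ (two points are joined if some block contains both); (v) for each $\alpha\in\{\alpha_1,\dots,\alpha_r\}$ there exist a point $P$ and a block $B$ with $P\notin B$ such that exactly $\alpha$ points of $B$ are joined to $P$. *)

theory Defs
  imports "HOL-Analysis.Analysis"
begin

section \<open>Generalized partial geometries\<close>

definition joined :: "'p set set \<Rightarrow> 'p \<Rightarrow> 'p \<Rightarrow> bool" where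
  "joined Bs x y \<longleftrightarrow> (\<exists>b\<in>Bs. x \<in> b \<and> y \<in> b)"

text \<open>The grade is the number of values in the list, so the values are required to be distinct.\<close>

definition generalized_partial_geometry ::
  "nat \<Rightarrow> nat \<Rightarrow> nat \<Rightarrow> nat list \<Rightarrow> 'p set \<Rightarrow> 'p set set \<Rightarrow> bool" where
  "generalized_partial_geometry r s t \<alpha>s P Bs \<longleftrightarrow>
     length \<alpha>s = r \<and> distinct \<alpha>s \<and>
     finite P \<and> P \<noteq> {} \<and> Bs \<subseteq> Pow P \<and>
     (\<forall>x\<in>P. \<forall>y\<in>P. x \<noteq> y \<longrightarrow>
        (\<forall>b\<in>Bs. \<forall>b'\<in>Bs. {x, y} \<subseteq> b \<and> {x, y} \<subseteq> b' \<longrightarrow> b = b')) \<and>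
     (\<forall>b\<in>Bs. card b = s + 1) \<and>
     (\<forall>x\<in>P. card {b\<in>Bs. x \<in> b} = t + 1) \<and>
     (\<forall>x\<in>P. \<forall>b\<in>Bs. x \<notin> b \<longrightarrow> card {y\<in>b. joined Bs x y} \<in> set \<alpha>s) \<and>
     (\<forall>\<alpha>\<in>set \<alpha>s. \<exists>x\<in>P. \<exists>b\<in>Bs. x \<notin> b \<and> card {y\<in>b. joined Bs x y} = \<alpha>)"


section \<open>Lines and quadrics of the projective 3-space over a field\<close>

text \<open>Subspaces of the projective space are linear subspaces of \<open>'a ^ 4\<close>, and a quadric is
  the cone of all vectors (zero included) on which its quadratic form vanishes.\<close>

definition pg3_line :: "('a::field ^ 4) set \<Rightarrow> bool" where
  "pg3_line l \<longleftrightarrow> vec.subspace l \<and> vec.dim l = 2"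

definition row_block :: "'a ^ 2 ^ 2 \<Rightarrow> 'a ^ 2 ^ 2 \<Rightarrow> 'a::zero ^ 4 ^ 2" where
  "row_block X Y = (\<chi> i. vector [X $ i $ 1, X $ i $ 2, Y $ i $ 1, Y $ i $ 2])"

definition row_span :: "'a::field ^ 4 ^ 2 \<Rightarrow> ('a ^ 4) set" where
  "row_span M = vec.span (rows M)"

definition base_line :: "('a::field ^ 4) set" where
  "base_line = row_span (row_block (mat 1) 0)"

definition lines1 :: "('a::field ^ 4) set set" where
  "lines1 = {l. pg3_line l \<and> l \<inter> base_line = {0}}"

text \<open>A hyperbolic quadric is one projectively equivalent to \<open>X\<^sub>1X\<^sub>2 + X\<^sub>3X\<^sub>4 = 0\<close>.\<close>

definition hyperbolic_quadric :: "('a::field ^ 4) set \<Rightarrow> bool" where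
  "hyperbolic_quadric Q \<longleftrightarrow>
     (\<exists>T :: 'a ^ 4 ^ 4. invertible T \<and>
        Q = {x. (T *v x) $ 1 * (T *v x) $ 2 + (T *v x) $ 3 * (T *v x) $ 4 = 0})"

definition quadrics1 :: "('a::field ^ 4) set set" where
  "quadrics1 = {Q. hyperbolic_quadric Q \<and> base_line \<subseteq> Q}"

definition block_of :: "('a::field ^ 4) set \<Rightarrow> ('a ^ 4) set set" where
  "block_of Q = {l\<in>lines1. l \<subseteq> Q}"

definition blocks1 :: "('a::field ^ 4) set set set" where
  "blocks1 = block_of ` quadrics1"


section \<open>Matrix descriptions\<close>

text \<open>In odd characteristic, lines of \<open>lines1\<close> are the row spaces of matrices \<open>(N I)\<close> (\<open>lines1_eq\<close>),
  members of \<open>quadrics1\<close> are the quadrics with matrix \<open>((0, B), (B\<^sup>T, C))\<close> (\<open>quadrics1_eq\<close>), and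
  their blocks are the solution sets of \<open>B\<^sup>TN\<^sup>T + NB + C = 0\<close> (\<open>blocks1_eq\<close>).\<close>

definition quadric :: "'a::field ^ 4 ^ 4 \<Rightarrow> ('a ^ 4) set" where
  "quadric A = {x. (\<Sum>i\<in>UNIV. x $ i * (A *v x) $ i) = 0}"

definition block_matrix :: "'a ^ 2 ^ 2 \<Rightarrow> 'a ^ 2 ^ 2 \<Rightarrow> 'a ^ 2 ^ 2 \<Rightarrow> 'a ^ 2 ^ 2 \<Rightarrow> 'a::zero ^ 4 ^ 4" where
  "block_matrix X Y Z W =
     vector [row_block X Y $ 1, row_block X Y $ 2, row_block Z W $ 1, row_block Z W $ 2]"

lemma vector_4_nth [simp]:
  "(vector [x, y, z, w] :: 'a::zero ^ 4) $ 1 = x"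
  "(vector [x, y, z, w] :: 'a::zero ^ 4) $ 2 = y"
  "(vector [x, y, z, w] :: 'a::zero ^ 4) $ 3 = z"
  "(vector [x, y, z, w] :: 'a::zero ^ 4) $ 4 = w"
  unfolding vector_def by simp_all

lemma mem_row_span:
  "x \<in> row_span M \<longleftrightarrow> (\<exists>c d. x = c *s M $ 1 + d *s M $ 2)"
proof -
  have r: "rows M = {M $ 1, M $ 2}"
    unfolding rows_def row_def by (auto simp: UNIV_2)
  show ?thesis
    unfolding row_span_def r vec.span_insert vec.span_empty
    by (auto simp: algebra_simps)
qed

lemma mem_base_line: "x \<in> base_line \<longleftrightarrow> x $ 3 = 0 \<and> x $ 4 = (0 :: 'a::field)"
  unfolding base_line_def mem_row_span row_block_def
  by (auto simp: vec_eq_iff forall_4 mat_def)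

lemma mem_row_span_lines1:
  "x \<in> row_span (row_block N (mat 1)) \<longleftrightarrow>
     x $ 1 = x $ 3 * N $ 1 $ 1 + x $ 4 * N $ 2 $ 1 \<and> x $ 2 = x $ 3 * N $ 1 $ 2 + x $ 4 * N $ 2 $ 2"
  unfolding mem_row_span row_block_def
  by (auto simp: vec_eq_iff forall_4 mat_def)

lemma lines1_eq: "(lines1 :: ('a::field ^ 4) set set) = range (\<lambda>N. row_span (row_block N (mat 1)))"
proof (intro set_eqI iffI)
  fix l :: "('a ^ 4) set"
  assume "l \<in> lines1"
  then have sub: "vec.subspace l" and dim: "vec.dim l = 2" and skew: "l \<inter> base_line = {0}"
    by (auto simp: lines1_def pg3_line_def)
  define E :: "'a ^ 4 ^ 2" where "E = row_block 0 (mat 1)"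
  have E: "(E *v x) $ 1 = x $ 3" "(E *v x) $ 2 = x $ 4" for x
    by (auto simp: E_def row_block_def matrix_vector_mult_def mat_def sum_4)
  have inj: "inj_on ((*v) E) (vec.span l)"
  proof (rule inj_onI)
    fix x y assume xy: "x \<in> vec.span l" "y \<in> vec.span l" "E *v x = E *v y"
    then have "x - y \<in> l"
      using sub by (metis vec.span_eq_iff vec.subspace_diff)
    moreover have "x - y \<in> base_line"
      using xy(3) E[of x] E[of y] by (simp add: mem_base_line)
    ultimately have "x - y = 0" using skew by blast
    then show "x = y" by simp
  qed
  have "vec.dim ((*v) E ` l) = 2"
    using vec.dim_image_eq[OF matrix_vector_mul_linear_gen inj] dim by simp
  then have "vec.dim (UNIV :: ('a ^ 2) set) \<le> vec.dim ((*v) E ` l)"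
    by (simp only: vec_dim_card) simp
  then have img: "(*v) E ` l = UNIV"
    by (rule vec.subspace_dim_equal[OF vec.subspace_image[OF sub] vec.subspace_UNIV subset_UNIV])
  have "vector [1, 0] \<in> (*v) E ` l" "vector [0, 1] \<in> (*v) E ` l"
    unfolding img by simp_all
  then obtain a b where a: "a \<in> l" "E *v a = vector [1, 0]" and b: "b \<in> l" "E *v b = vector [0, 1]"
    by (elim imageE) simp
  have a': "a $ 3 = 1" "a $ 4 = 0" and b': "b $ 3 = 0" "b $ 4 = 1"
    using a(2) b(2) E[of a] E[of b] by auto
  define N :: "'a ^ 2 ^ 2" where "N = vector [vector [a $ 1, a $ 2], vector [b $ 1, b $ 2]]"
  have rows: "row_block N (mat 1) $ 1 = a" "row_block N (mat 1) $ 2 = b"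
    using a' b' by (auto simp: row_block_def N_def vec_eq_iff forall_4 mat_def)
  have "l = row_span (row_block N (mat 1))"
  proof (intro set_eqI iffI)
    fix x assume x: "x \<in> l"
    let ?y = "x - (x $ 3 *s a + x $ 4 *s b)"
    have "?y \<in> l"
      using x a b sub by (intro vec.subspace_diff vec.subspace_add vec.subspace_scale)
    moreover have "?y \<in> base_line"
      using a' b' by (simp add: mem_base_line)
    ultimately have "?y = 0" using skew by blast
    then have "x = x $ 3 *s a + x $ 4 *s b" by simp
    then show "x \<in> row_span (row_block N (mat 1))"
      unfolding mem_row_span rows by blast
  next
    fix x assume "x \<in> row_span (row_block N (mat 1))"
    then show "x \<in> l"
      unfolding mem_row_span rows
      using a b sub by (auto intro!: vec.subspace_add vec.subspace_scale)
  qed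
  then show "l \<in> range (\<lambda>N. row_span (row_block N (mat 1)))" by blast
next
  fix l :: "('a ^ 4) set"
  assume "l \<in> range (\<lambda>N. row_span (row_block N (mat 1)))"
  then obtain N where l: "l = row_span (row_block N (mat 1))" by blast
  define a b where ab: "a = row_block N (mat 1) $ 1" "b = row_block N (mat 1) $ 2"
  have a': "a $ 3 = 1" "a $ 4 = 0" and b': "b $ 3 = 0" "b $ 4 = 1"
    by (auto simp: ab row_block_def mat_def)
  have r: "rows (row_block N (mat 1)) = {a, b}"
    unfolding rows_def row_def ab by (auto simp: UNIV_2)
  have ne: "a \<noteq> b" using a' b' by auto
  have b0: "b \<noteq> 0" using b' by auto
  have "a \<notin> vec.span {b}"
    using a' b' by (auto simp: vec.span_singleton)
  then have "vec.independent {a, b}"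
    using b0 by (simp add: vec.independent_insert ne vec.dependent_single)
  then have "vec.dim l = 2"
    unfolding l row_span_def r using ne by (simp add: vec.dim_eq_card_independent)
  moreover have "vec.subspace l"
    unfolding l row_span_def by simp
  moreover have "l \<inter> base_line = {0}"
    unfolding l by (auto simp: mem_row_span_lines1 mem_base_line vec_eq_iff forall_4)
  ultimately show "l \<in> lines1"
    by (simp add: lines1_def pg3_line_def)
qed

lemma quadric_block_matrix:
  "x \<in> quadric (block_matrix 0 B (transpose B) C) \<longleftrightarrow>
     2 * (x $ 1 * (B $ 1 $ 1 * x $ 3 + B $ 1 $ 2 * x $ 4) +
          x $ 2 * (B $ 2 $ 1 * x $ 3 + B $ 2 $ 2 * x $ 4)) +
     (x $ 3 * (C $ 1 $ 1 * x $ 3 + C $ 1 $ 2 * x $ 4) +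
      x $ 4 * (C $ 2 $ 1 * x $ 3 + C $ 2 $ 2 * x $ 4)) = (0 :: 'a::field)"
  unfolding quadric_def block_matrix_def row_block_def
  by (simp add: sum_4 matrix_vector_mult_def transpose_def algebra_simps)

lemma invertible_transposeI:
  fixes A :: "'a::field ^ 'n ^ 'n"
  assumes "invertible A"
  shows "invertible (transpose A)"
  by (meson assms invertible_def matrix_left_right_inverse right_invertible_transpose)

lemma quadrics1_eq:
  assumes two: "(2 :: 'a::field) \<noteq> 0"
  shows "(quadrics1 :: ('a ^ 4) set set) =
    {quadric (block_matrix 0 B (transpose B) C) | B C. invertible B \<and> transpose C = C}"
proof (intro set_eqI iffI)
  fix Q :: "('a ^ 4) set"
  assume "Q \<in> quadrics1"
  then obtain T :: "'a ^ 4 ^ 4" where T: "invertible T"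
    and Q: "Q = {x. (T *v x) $ 1 * (T *v x) $ 2 + (T *v x) $ 3 * (T *v x) $ 4 = 0}"
    and base: "base_line \<subseteq> Q"
    by (auto simp: quadrics1_def hyperbolic_quadric_def)
  define t where "t i j = T $ i $ j" for i j
  have Tx: "(T *v x) $ i = t i 1 * x $ 1 + t i 2 * x $ 2 + t i 3 * x $ 3 + t i 4 * x $ 4" for x i
    by (simp add: matrix_vector_mult_def sum_4 t_def)
  have pts: "vector [c, d, 0, 0] \<in> Q" for c d
    using base by (auto simp: mem_base_line)
  have h11: "t 1 1 * t 2 1 + t 3 1 * t 4 1 = 0"
    using pts[of 1 0] by (simp add: Q Tx)
  have h22: "t 1 2 * t 2 2 + t 3 2 * t 4 2 = 0"
    using pts[of 0 1] by (simp add: Q Tx)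
  have h12: "t 1 1 * t 2 2 + t 1 2 * t 2 1 + t 3 1 * t 4 2 + t 3 2 * t 4 1 = 0"
  proof -
    have "(t 1 1 + t 1 2) * (t 2 1 + t 2 2) + (t 3 1 + t 3 2) * (t 4 1 + t 4 2) = 0"
      using pts[of 1 1] by (simp add: Q Tx)
    then show ?thesis using h11 h22 by algebra
  qed
  define b where "b j k = t 1 j * t 2 k + t 1 k * t 2 j + t 3 j * t 4 k + t 3 k * t 4 j" for j k
  define B :: "'a ^ 2 ^ 2" where "B = vector [vector [b 1 3, b 1 4], vector [b 2 3, b 2 4]]"
  define C :: "'a ^ 2 ^ 2" where "C = vector [vector [b 3 3, b 3 4], vector [b 3 4, b 4 4]]"
  have C: "transpose C = C"
    by (simp add: C_def transpose_def vec_eq_iff forall_2)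
  have "x \<in> Q \<longleftrightarrow> x \<in> quadric (block_matrix 0 B (transpose B) C)" for x
  proof -
    let ?h = "(T *v x) $ 1 * (T *v x) $ 2 + (T *v x) $ 3 * (T *v x) $ 4"
    have "2 * ?h = 2 * (x $ 1 * (B $ 1 $ 1 * x $ 3 + B $ 1 $ 2 * x $ 4) +
          x $ 2 * (B $ 2 $ 1 * x $ 3 + B $ 2 $ 2 * x $ 4)) +
     (x $ 3 * (C $ 1 $ 1 * x $ 3 + C $ 1 $ 2 * x $ 4) +
      x $ 4 * (C $ 2 $ 1 * x $ 3 + C $ 2 $ 2 * x $ 4))
      + 2 * (x $ 1 * x $ 1 * (t 1 1 * t 2 1 + t 3 1 * t 4 1)
      + x $ 1 * x $ 2 * (t 1 1 * t 2 2 + t 1 2 * t 2 1 + t 3 1 * t 4 2 + t 3 2 * t 4 1)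
      + x $ 2 * x $ 2 * (t 1 2 * t 2 2 + t 3 2 * t 4 2))"
      unfolding Tx B_def C_def b_def vector_2 by (simp add: algebra_simps)
    then have "2 * ?h = 0 \<longleftrightarrow> x \<in> quadric (block_matrix 0 B (transpose B) C)"
      unfolding quadric_block_matrix h11 h22 h12 by simp
    moreover have "x \<in> Q \<longleftrightarrow> 2 * ?h = 0"
      using two by (simp only: Q mem_Collect_eq mult_eq_0_iff simp_thms)
    ultimately show ?thesis by simp
  qed
  then have eq: "Q = quadric (block_matrix 0 B (transpose B) C)" by blast
  have "u = 0" if u: "transpose B *v u = 0" for u
  proof -
    define y :: "'a ^ 4" where "y = vector [u $ 1, u $ 2, 0, 0]"
    have u1: "b 1 3 * u $ 1 + b 2 3 * u $ 2 = 0" and u2: "b 1 4 * u $ 1 + b 2 4 * u $ 2 = 0"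
      using u by (simp_all add: vec_eq_iff forall_2 matrix_vector_mult_def transpose_def sum_2 B_def)
    have pol: "(T *v y) $ 1 * (T *v x) $ 2 + (T *v y) $ 2 * (T *v x) $ 1 +
        (T *v y) $ 3 * (T *v x) $ 4 + (T *v y) $ 4 * (T *v x) $ 3 = 0" for x
    proof -
      have "(T *v y) $ 1 * (T *v x) $ 2 + (T *v y) $ 2 * (T *v x) $ 1 +
        (T *v y) $ 3 * (T *v x) $ 4 + (T *v y) $ 4 * (T *v x) $ 3 =
        x $ 3 * (b 1 3 * u $ 1 + b 2 3 * u $ 2) + x $ 4 * (b 1 4 * u $ 1 + b 2 4 * u $ 2)
        + 2 * u $ 1 * x $ 1 * (t 1 1 * t 2 1 + t 3 1 * t 4 1)
        + (u $ 1 * x $ 2 + u $ 2 * x $ 1)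
            * (t 1 1 * t 2 2 + t 1 2 * t 2 1 + t 3 1 * t 4 2 + t 3 2 * t 4 1)
        + 2 * u $ 2 * x $ 2 * (t 1 2 * t 2 2 + t 3 2 * t 4 2)"
        unfolding Tx b_def y_def by (simp add: algebra_simps)
      then show ?thesis unfolding h11 h22 h12 u1 u2 by simp
    qed
    obtain T' where T': "T ** T' = mat 1" "T' ** T = mat 1"
      using T by (auto simp: invertible_def)
    have surj: "T *v (T' *v z) = z" for z
      by (simp add: matrix_vector_mul_assoc T')
    have "(T *v y) $ i = 0" for i
      using exhaust_4[of i] pol[of "T' *v vector [1, 0, 0, 0]"] pol[of "T' *v vector [0, 1, 0, 0]"]
        pol[of "T' *v vector [0, 0, 1, 0]"] pol[of "T' *v vector [0, 0, 0, 1]"]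
      unfolding surj by auto
    then have "T *v y = 0" by (simp add: vec_eq_iff)
    then have "T' *v (T *v y) = 0" by simp
    then have "y = 0" by (simp add: matrix_vector_mul_assoc T')
    then show "u = 0" by (simp add: y_def vec_eq_iff forall_2 forall_4)
  qed
  then have "invertible (transpose B)"
    unfolding invertible_left_inverse matrix_left_invertible_ker by blast
  then have "invertible B"
    using invertible_transposeI[of "transpose B"] by simp
  then show "Q \<in> {quadric (block_matrix 0 B (transpose B) C) | B C. invertible B \<and> transpose C = C}"
    using eq C by blast
next
  fix Q :: "('a ^ 4) set"
  assume "Q \<in> {quadric (block_matrix 0 B (transpose B) C) | B C. invertible B \<and> transpose C = C}"
  then obtain B C where B: "invertible B" and C: "transpose C = C"
    and Q: "Q = quadric (block_matrix 0 B (transpose B) C)" by blast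
  define T :: "'a ^ 4 ^ 4" where "T = vector [vector [0, 0, 1, 0],
    vector [2 * B $ 1 $ 1, 2 * B $ 2 $ 1, C $ 1 $ 1, C $ 1 $ 2], vector [0, 0, 0, 1],
    vector [2 * B $ 1 $ 2, 2 * B $ 2 $ 2, C $ 2 $ 1, C $ 2 $ 2]]"
  have Tx: "(T *v x) $ 1 = x $ 3" "(T *v x) $ 3 = x $ 4"
    "(T *v x) $ 2 = 2 * (B $ 1 $ 1 * x $ 1 + B $ 2 $ 1 * x $ 2) + (C $ 1 $ 1 * x $ 3 + C $ 1 $ 2 * x $ 4)"
    "(T *v x) $ 4 = 2 * (B $ 1 $ 2 * x $ 1 + B $ 2 $ 2 * x $ 2) + (C $ 2 $ 1 * x $ 3 + C $ 2 $ 2 * x $ 4)"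
    for x by (simp_all add: T_def matrix_vector_mult_def sum_4 algebra_simps)
  have "invertible (transpose B)" using B by (rule invertible_transposeI)
  then have ker: "u = 0" if "transpose B *v u = 0" for u
    using that unfolding invertible_left_inverse matrix_left_invertible_ker by blast
  have "x = 0" if x: "T *v x = 0" for x
  proof -
    have x34: "x $ 3 = 0" "x $ 4 = 0"
      using Tx(1,2)[of x] x by simp_all
    have "B $ 1 $ 1 * x $ 1 + B $ 2 $ 1 * x $ 2 = 0" "B $ 1 $ 2 * x $ 1 + B $ 2 $ 2 * x $ 2 = 0"
      using Tx(3,4)[of x] two unfolding x x34 by (simp_all del: distrib_left_numeral)
    then have "transpose B *v vector [x $ 1, x $ 2] = 0"
      by (simp add: vec_eq_iff forall_2 matrix_vector_mult_def transpose_def sum_2)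
    then have "(vector [x $ 1, x $ 2] :: 'a ^ 2) = 0" by (rule ker)
    then show "x = 0" using x34 by (simp add: vec_eq_iff forall_2 forall_4)
  qed
  then have "invertible T"
    unfolding invertible_left_inverse matrix_left_invertible_ker by blast
  moreover have "Q = {x. (T *v x) $ 1 * (T *v x) $ 2 + (T *v x) $ 3 * (T *v x) $ 4 = 0}"
    unfolding Q Tx by (auto simp: quadric_block_matrix algebra_simps)
  moreover have "base_line \<subseteq> Q"
    by (auto simp: Q mem_base_line quadric_block_matrix)
  ultimately show "Q \<in> quadrics1"
    by (auto simp: quadrics1_def hyperbolic_quadric_def)
qed

lemma row_span_subset_quadric:
  assumes two: "(2 :: 'a::field) \<noteq> 0" and C: "transpose C = (C :: 'a ^ 2 ^ 2)"
  shows "row_span (row_block N (mat 1)) \<subseteq> quadric (block_matrix 0 B (transpose B) C) \<longleftrightarrow>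
    transpose B ** transpose N + N ** B + C = 0"
proof -
  define S where "S = transpose B ** transpose N + N ** B + C"
  have C21: "C $ 2 $ 1 = C $ 1 $ 2"
    using arg_cong[OF C, of "\<lambda>M. M $ 2 $ 1"] by (simp add: transpose_def)
  have S: "S $ 1 $ 1 = 2 * (N $ 1 $ 1 * B $ 1 $ 1 + N $ 1 $ 2 * B $ 2 $ 1) + C $ 1 $ 1"
    "S $ 2 $ 2 = 2 * (N $ 2 $ 1 * B $ 1 $ 2 + N $ 2 $ 2 * B $ 2 $ 2) + C $ 2 $ 2"
    "S $ 1 $ 2 = B $ 1 $ 1 * N $ 2 $ 1 + B $ 2 $ 1 * N $ 2 $ 2 + N $ 1 $ 1 * B $ 1 $ 2
       + N $ 1 $ 2 * B $ 2 $ 2 + C $ 1 $ 2"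
    "S $ 2 $ 1 = S $ 1 $ 2"
    by (simp_all add: S_def C21 matrix_matrix_mult_def transpose_def sum_2 algebra_simps)
  have val: "vector [c * N $ 1 $ 1 + d * N $ 2 $ 1, c * N $ 1 $ 2 + d * N $ 2 $ 2, c, d]
      \<in> quadric (block_matrix 0 B (transpose B) C) \<longleftrightarrow>
      c * c * S $ 1 $ 1 + 2 * (c * d * S $ 1 $ 2) + d * d * S $ 2 $ 2 = 0" for c d
    unfolding quadric_block_matrix vector_4_nth S C21 by (simp add: algebra_simps)
  have "row_span (row_block N (mat 1)) =
    {vector [c * N $ 1 $ 1 + d * N $ 2 $ 1, c * N $ 1 $ 2 + d * N $ 2 $ 2, c, d] | c d. True}"
    unfolding set_eq_iff mem_row_span_lines1 mem_Collect_eq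
    by (auto simp: vec_eq_iff forall_4)
  then have "row_span (row_block N (mat 1)) \<subseteq> quadric (block_matrix 0 B (transpose B) C) \<longleftrightarrow>
    (\<forall>c d. c * c * S $ 1 $ 1 + 2 * (c * d * S $ 1 $ 2) + d * d * S $ 2 $ 2 = 0)"
    unfolding val[symmetric] by auto
  also have "\<dots> \<longleftrightarrow> S = 0"
  proof
    assume H: "\<forall>c d. c * c * S $ 1 $ 1 + 2 * (c * d * S $ 1 $ 2) + d * d * S $ 2 $ 2 = 0"
    have "S $ 1 $ 1 = 0" "S $ 2 $ 2 = 0"
      using H[rule_format, of 1 0] H[rule_format, of 0 1] by simp_all
    moreover from this have "S $ 1 $ 2 = 0"
      using H[rule_format, of 1 1] two by simp
    ultimately show "S = 0"
      using S(4) by (simp add: vec_eq_iff forall_2)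
  qed simp
  finally show ?thesis unfolding S_def .
qed

theorem blocks1_eq:
  assumes two: "(2 :: 'a::field) \<noteq> 0"
  shows "(blocks1 :: ('a ^ 4) set set set) =
    {{row_span (row_block N (mat 1)) | N. transpose B ** transpose N + N ** B + C = 0} | B C.
      invertible B \<and> transpose C = C}"
proof -
  have "block_of (quadric (block_matrix 0 B (transpose B) C)) =
      {row_span (row_block N (mat 1)) | N. transpose B ** transpose N + N ** B + C = 0}"
    if "transpose C = C" for B C :: "'a ^ 2 ^ 2"
    unfolding block_of_def lines1_eq using row_span_subset_quadric[OF two that] by auto
  note block = this
  have "(blocks1 :: ('a ^ 4) set set set) =
      {block_of (quadric (block_matrix 0 B (transpose B) C)) | B C. invertible B \<and> transpose C = C}"
    unfolding blocks1_def quadrics1_eq[OF two] by blast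
  also have "\<dots> = {{row_span (row_block N (mat 1)) | N. transpose B ** transpose N + N ** B + C = 0} | B C.
      invertible B \<and> transpose C = C}"
    by (simp only: block cong: rev_conj_cong)
  finally show ?thesis .
qed

end

theory Submission
  imports Defs
begin

text \<open>Identify the line \<open>(N I)\<close> with the matrix \<open>N\<close>. Since \<open>N B\<close> must have symmetric part
  \<open>- C / 2\<close>, a block is an affine line \<open>N\<^sub>0 + \<langle>M\<rangle>\<close> of the space of \<open>2 \<times> 2\<close> matrices with
  invertible direction \<open>M = J B\<^sup>-\<^sup>1\<close>, \<open>J\<close> skew, and every such affine line occurs. So two points are
  joined iff their difference is invertible, and the points of \<open>N\<^sub>0 + \<langle>M\<rangle>\<close> not joined to \<open>X\<close> are
  given by the roots of the quadratic polynomial \<open>det (N\<^sub>0 - X + a M)\<close> in \<open>a\<close>.\<close>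

section \<open>Finite fields of odd order\<close>

text \<open>Translation by 1 permutes the field, so comparing the sums of all elements before and
  after it shows that the field order is 0 in the field. If 2 were 0, an odd order would also equal
  1 there.\<close>

lemma two_neq_zero_if_odd_CARD:
  assumes "odd CARD('a::{field,finite})"
  shows "(2 :: 'a) \<noteq> 0"
proof
  assume two: "(2 :: 'a) = 0"
  have "(\<Sum>x \<in> UNIV. x + 1 :: 'a) = (\<Sum>x \<in> UNIV. x)"
    by (rule sum.reindex_bij_witness[of _ "\<lambda>x. x - 1" "\<lambda>x. x + 1"]) auto
  then have "of_nat CARD('a) = (0 :: 'a)" by (simp add: sum.distrib)
  moreover obtain k where "CARD('a) = 2 * k + 1" using assms by (rule oddE)
  ultimately show False using two by simp
qed

lemma CARD_gt_1: "1 < CARD('a::{zero_neq_one,finite})"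
proof -
  have "card {0, 1 :: 'a} \<le> CARD('a)" by (rule card_mono[OF finite subset_UNIV])
  moreover have "card {0, 1 :: 'a} = 2" by simp
  ultimately have "2 \<le> CARD('a)" by metis
  then show ?thesis by linarith
qed

section \<open>Transport along an injective map\<close>

text \<open>Lets everything be proved for 2 x 2 matrices and then be carried over to lines by
  sending N to the row space of (N I). Injectivity on points makes the induced map on blocks
  injective too, so all counts survive.\<close>

lemma generalized_partial_geometry_image:
  assumes inj: "inj_on f P" and gpg: "generalized_partial_geometry r s t \<alpha>s P Bs"
  shows "generalized_partial_geometry r s t \<alpha>s (f ` P) ((`) f ` Bs)"
proof -
  have sub: "Bs \<subseteq> Pow P" using gpg by (simp add: generalized_partial_geometry_def)
  have mem: "f x \<in> f ` b \<longleftrightarrow> x \<in> b" if "x \<in> P" "b \<in> Bs" for x b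
    using inj that sub by (intro inj_on_image_mem_iff[where B = P]) auto
  have card: "card (f ` b) = card b" if "b \<subseteq> P" for b
    using inj that by (intro card_image) (rule inj_on_subset)
  have through: "card {b \<in> (`) f ` Bs. f x \<in> b} = card {b \<in> Bs. x \<in> b}" if "x \<in> P" for x
  proof -
    have "{b \<in> (`) f ` Bs. f x \<in> b} = (`) f ` {b \<in> Bs. x \<in> b}"
      using mem that by auto
    moreover have "inj_on ((`) f) {b \<in> Bs. x \<in> b}"
      using sub by (intro inj_on_subset[OF inj_on_image_Pow[OF inj]]) auto
    ultimately show ?thesis by (simp add: card_image)
  qed
  have join: "card {y \<in> f ` b. joined ((`) f ` Bs) (f x) y} = card {y \<in> b. joined Bs x y}"
    if "x \<in> P" "b \<in> Bs" for x b
  proof -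
    have "{y \<in> f ` b. joined ((`) f ` Bs) (f x) y} = f ` {y \<in> b. joined Bs x y}"
    proof -
      have "joined ((`) f ` Bs) (f x) (f y) \<longleftrightarrow> joined Bs x y" if "y \<in> b" for y
      proof -
        have "y \<in> P" using \<open>b \<in> Bs\<close> \<open>y \<in> b\<close> sub by blast
        then show ?thesis using mem \<open>x \<in> P\<close> by (simp add: joined_def)
      qed
      then show ?thesis by blast
    qed
    moreover have "{y \<in> b. joined Bs x y} \<subseteq> P" using that sub by blast
    ultimately show ?thesis by (simp only: card)
  qed
  show ?thesis
    unfolding generalized_partial_geometry_def
  proof (intro conjI)
    show "(`) f ` Bs \<subseteq> Pow (f ` P)" using sub by blast
    show "\<forall>x\<in>f ` P. \<forall>y\<in>f ` P. x \<noteq> y \<longrightarrow>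
        (\<forall>b\<in>(`) f ` Bs. \<forall>b'\<in>(`) f ` Bs. {x, y} \<subseteq> b \<and> {x, y} \<subseteq> b' \<longrightarrow> b = b')"
    proof (intro ballI impI)
      fix x' y' b b'
      assume "x' \<in> f ` P" "y' \<in> f ` P" "b \<in> (`) f ` Bs" "b' \<in> (`) f ` Bs" and ne: "x' \<noteq> y'"
        and on: "{x', y'} \<subseteq> b \<and> {x', y'} \<subseteq> b'"
      then obtain x y c c' where *: "x \<in> P" "y \<in> P" "c \<in> Bs" "c' \<in> Bs"
        "x' = f x" "y' = f y" "b = f ` c" "b' = f ` c'" by blast
      with on have "{x, y} \<subseteq> c" "{x, y} \<subseteq> c'" by (simp_all add: mem)
      moreover have "x \<noteq> y" using * ne by blast
      ultimately have "c = c'"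
        using * gpg unfolding generalized_partial_geometry_def by blast
      then show "b = b'" using * by simp
    qed
    show "\<forall>b\<in>(`) f ` Bs. card b = s + 1"
      using gpg sub card unfolding generalized_partial_geometry_def by auto
    show "\<forall>x\<in>f ` P. card {b \<in> (`) f ` Bs. x \<in> b} = t + 1"
      using gpg through unfolding generalized_partial_geometry_def by auto
    show "\<forall>x\<in>f ` P. \<forall>b\<in>(`) f ` Bs. x \<notin> b \<longrightarrow>
        card {y \<in> b. joined ((`) f ` Bs) x y} \<in> set \<alpha>s"
      using gpg unfolding generalized_partial_geometry_def by (simp add: mem join)
    show "\<forall>\<alpha>\<in>set \<alpha>s. \<exists>x\<in>f ` P. \<exists>b\<in>(`) f ` Bs. x \<notin> b \<and>
        card {y \<in> b. joined ((`) f ` Bs) x y} = \<alpha>"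
      using gpg unfolding generalized_partial_geometry_def by (simp add: mem join)
  qed (use gpg in \<open>simp_all add: generalized_partial_geometry_def\<close>)
qed

section \<open>Affine lines of matrices with invertible direction\<close>

text \<open>The product \<open>mat a ** M\<close> is the scalar multiple of M by a; on
  \<open>'a ^ 2 ^ 2\<close> the operator \<open>*s\<close> would take its scalars from
  \<open>'a ^ 2\<close>.\<close>

definition matrix_line :: "'a::field ^ 2 ^ 2 \<Rightarrow> 'a ^ 2 ^ 2 \<Rightarrow> ('a ^ 2 ^ 2) set" where
  "matrix_line N M = range (\<lambda>a. N + mat a ** M)"

text \<open>In the affine 4-space of matrices, these are the lines whose point at infinity lies off
  the hyperbolic quadric \<open>det M = 0\<close>.\<close>

definition matrix_lines :: "('a::field ^ 2 ^ 2) set set" where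
  "matrix_lines = {matrix_line N M | N M. det M \<noteq> 0}"

lemma mat_mult_nth: "(mat a ** M) $ i $ j = a * M $ i $ j" for M :: "'a::field ^ 2 ^ 2"
  using exhaust_2[of i] by (auto simp: matrix_matrix_mult_def mat_def sum_2)

text \<open>The determinant is a quadratic form on 2 x 2 matrices, and the middle coefficient is its
  polar form at N and M.\<close>

lemma det_add_mat_mult:
  fixes N M :: "'a::field ^ 2 ^ 2"
  shows "det (N + mat a ** M) = det N
    + a * (N $ 1 $ 1 * M $ 2 $ 2 + N $ 2 $ 2 * M $ 1 $ 1 - N $ 1 $ 2 * M $ 2 $ 1 - N $ 2 $ 1 * M $ 1 $ 2)
    + a\<^sup>2 * det M"
  by (simp add: det_2 mat_mult_nth algebra_simps power2_eq_square)

lemma inj_matrix_line: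
  assumes "det M \<noteq> (0 :: 'a::field)"
  shows "inj (\<lambda>a. N + mat a ** M :: 'a ^ 2 ^ 2)"
proof (rule injI)
  fix a b assume "N + mat a ** M = N + mat b ** M"
  then have "mat a ** M = mat b ** M" by simp
  then have "a * M $ i $ j = b * M $ i $ j" for i j by (metis mat_mult_nth)
  then have *: "M $ i $ j = 0" if "a \<noteq> b" for i j using that by (metis mult_cancel_right)
  show "a = b" using assms by (rule contrapos_np) (simp add: det_2 *)
qed

lemma matrix_line_cong:
  assumes "x \<in> matrix_line N M" "y \<in> matrix_line N M" "x \<noteq> y"
  shows "matrix_line N M = matrix_line x (y - x)"
proof -
  obtain a b where x: "x = N + mat a ** M" and y: "y = N + mat b ** M"
    using assms(1,2) by (auto simp: matrix_line_def)
  have ab: "b - a \<noteq> 0" using assms(3) x y by auto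
  \<comment> \<open>The affine change of parameter sending a to 0 and b to 1, followed below by its
    inverse.\<close>
  have 1: "N + mat c ** M = x + mat ((c - a) / (b - a)) ** (y - x)" for c
    using ab by (simp add: vec_eq_iff x y mat_mult_nth field_simps)
  have 2: "x + mat c ** (y - x) = N + mat (a + c * (b - a)) ** M" for c
    by (simp add: vec_eq_iff x y mat_mult_nth field_simps)
  show ?thesis unfolding matrix_line_def using 1 2 by blast
qed

lemma det_diff_matrix_line:
  assumes "x \<in> matrix_line N M" "y \<in> matrix_line N M" "x \<noteq> y" "det M \<noteq> 0"
  shows "det (y - x) \<noteq> 0"
proof -
  obtain a b where x: "x = N + mat a ** M" and y: "y = N + mat b ** M"
    using assms(1,2) by (auto simp: matrix_line_def)
  \<comment> \<open>The difference is b - a times M, and the determinant is homogeneous of degree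
    2.\<close>
  have "det (y - x) = (b - a)\<^sup>2 * det M"
    by (simp add: x y det_2 mat_mult_nth algebra_simps power2_eq_square)
  moreover have "b - a \<noteq> 0" using assms(3) x y by auto
  ultimately show ?thesis using assms(4) by simp
qed

lemma in_matrix_line: "x \<in> matrix_line x M" "y \<in> matrix_line x (y - x)"
proof -
  show "x \<in> matrix_line x M"
    unfolding matrix_line_def by (rule range_eqI[of _ _ 0]) (simp add: vec_eq_iff mat_mult_nth)
  show "y \<in> matrix_line x (y - x)"
    unfolding matrix_line_def by (rule range_eqI[of _ _ 1]) (simp add: vec_eq_iff mat_mult_nth)
qed

text \<open>The common source of the uniqueness axiom, the criterion for being joined, and the
  disjointness in the count of blocks through a point.\<close>

lemma matrix_lines_through_two:
  assumes "x \<noteq> y"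
  shows "b \<in> matrix_lines \<and> x \<in> b \<and> y \<in> b \<longleftrightarrow> det (y - x) \<noteq> 0 \<and> b = matrix_line x (y - x)"
proof
  assume "b \<in> matrix_lines \<and> x \<in> b \<and> y \<in> b"
  then obtain N M where "b = matrix_line N M" "det M \<noteq> 0" "x \<in> matrix_line N M" "y \<in> matrix_line N M"
    by (auto simp: matrix_lines_def)
  then show "det (y - x) \<noteq> 0 \<and> b = matrix_line x (y - x)"
    using assms matrix_line_cong det_diff_matrix_line by metis
next
  assume "det (y - x) \<noteq> 0 \<and> b = matrix_line x (y - x)"
  then show "b \<in> matrix_lines \<and> x \<in> b \<and> y \<in> b"
    using in_matrix_line unfolding matrix_lines_def by blast
qed

lemma joined_matrix_lines:
  assumes "x \<noteq> y"
  shows "joined matrix_lines x y \<longleftrightarrow> det (y - x) \<noteq> 0"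
  unfolding joined_def using matrix_lines_through_two[OF assms] by blast

section \<open>Counting points and blocks\<close>

lemma card_matrix_line:
  fixes M :: "'a::{field,finite} ^ 2 ^ 2"
  assumes "det M \<noteq> 0"
  shows "card (matrix_line N M) = CARD('a)"
  unfolding matrix_line_def using inj_matrix_line[OF assms] by (rule card_image)

lemma card_joined_matrix_line:
  fixes M :: "'a::{field,finite} ^ 2 ^ 2"
  assumes M: "det M \<noteq> 0" and x: "x \<notin> matrix_line N M"
  shows "card {y \<in> matrix_line N M. joined matrix_lines x y}
    = CARD('a) - card {a. det ((N - x) + mat a ** M) = 0}"
proof -
  \<comment> \<open>The criterion for being joined needs distinct points; since x is off the line,
    it applies to every y on it.\<close>
  have "{y \<in> matrix_line N M. joined matrix_lines x y}
      = {y \<in> matrix_line N M. det (y - x) \<noteq> 0}"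
    using x by (intro Collect_cong conj_cong joined_matrix_lines refl) blast
  also have "\<dots> = (\<lambda>a. N + mat a ** M) ` (- {a. det ((N - x) + mat a ** M) = 0})"
    unfolding matrix_line_def by (auto simp: algebra_simps)
  finally show ?thesis
    using inj_on_subset[OF inj_matrix_line[OF M] subset_UNIV]
    by (simp add: card_image Compl_eq_Diff_UNIV card_Diff_subset)
qed

text \<open>Invertibility of M keeps the leading coefficient nonzero, so the polynomial is not zero
  and has at most as many roots as its degree.\<close>

lemma card_quadratic_roots:
  fixes M :: "'a::{field,finite} ^ 2 ^ 2"
  assumes "det M \<noteq> 0"
  shows "card {a. det (N + mat a ** M) = 0} \<le> 2"
proof -
  let ?c = "N $ 1 $ 1 * M $ 2 $ 2 + N $ 2 $ 2 * M $ 1 $ 1 - N $ 1 $ 2 * M $ 2 $ 1 - N $ 2 $ 1 * M $ 1 $ 2"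
  let ?p = "[:det N, ?c, det M:]"
  have "{a. det (N + mat a ** M) = 0} = {a. poly ?p a = 0}"
    by (simp add: det_add_mat_mult algebra_simps power2_eq_square)
  moreover have "card {a. poly ?p a = 0} \<le> degree ?p"
    using assms by (intro card_poly_roots_bound) auto
  moreover have "degree ?p \<le> 2" by simp
  ultimately show ?thesis by simp
qed

text \<open>The order of the general linear group: choose a nonzero first row, then a second row
  that is not a multiple of it.\<close>

lemma card_det_nonzero:
  "card {M :: 'a::{field,finite} ^ 2 ^ 2. det M \<noteq> 0} = (CARD('a)\<^sup>2 - 1) * (CARD('a)\<^sup>2 - CARD('a))"
proof -
  define W where "W v = {w :: 'a ^ 2. v $ 1 * w $ 2 - v $ 2 * w $ 1 \<noteq> 0}" for v :: "'a ^ 2"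
  have cardW: "card (W v) = CARD('a)\<^sup>2 - CARD('a)" if "v \<noteq> 0" for v
  proof -
    \<comment> \<open>\<open>W\<close> asks the determinant with rows v and w to be nonzero, and it
      vanishes exactly on the multiples of v. The case split finds a nonzero coordinate of v to
      divide by.\<close>
    have "- W v = range (\<lambda>t. t *s v)"
    proof (intro set_eqI iffI)
      fix w assume "w \<in> - W v"
      then have e: "v $ 1 * w $ 2 = v $ 2 * w $ 1" by (simp add: W_def)
      show "w \<in> range (\<lambda>t. t *s v)"
      proof (cases "v $ 1 = 0")
        case True
        then have "v $ 2 \<noteq> 0" using that by (auto simp: vec_eq_iff forall_2)
        then have "w = (w $ 2 / v $ 2) *s v" using e True by (simp add: vec_eq_iff forall_2)
        then show ?thesis by blast
      next
        case False
        then have "w = (w $ 1 / v $ 1) *s v" using e by (simp add: vec_eq_iff forall_2 field_simps)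
        then show ?thesis by blast
      qed
    qed (auto simp: W_def)
    moreover have "inj (\<lambda>t. t *s v)"
      using that by (auto intro!: injI)
    ultimately have "card (- W v) = CARD('a)" by (simp add: card_image)
    moreover have "card (- (- W v)) = CARD('a ^ 2) - card (- W v)"
      by (simp only: Compl_eq_Diff_UNIV card_Diff_subset finite subset_UNIV)
    ultimately show ?thesis by simp
  qed
  have "bij_betw (\<lambda>M :: 'a ^ 2 ^ 2. (M $ 1, M $ 2)) {M. det M \<noteq> 0} (SIGMA v : - {0}. W v)"
  proof (rule bij_betw_byWitness[where f' = "\<lambda>(v, w). vector [v, w]"])
    show "(\<lambda>M :: 'a ^ 2 ^ 2. (M $ 1, M $ 2)) ` {M. det M \<noteq> 0} \<subseteq> (SIGMA v : - {0}. W v)"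
      by (auto simp: W_def det_2)
    show "(\<lambda>(v, w). vector [v, w]) ` (SIGMA v : - {0}. W v) \<subseteq> {M. det M \<noteq> 0}"
      by (auto simp: W_def det_2)
  qed (auto simp: vec_eq_iff forall_2)
  then have "card {M :: 'a ^ 2 ^ 2. det M \<noteq> 0} = card (SIGMA v : - {0}. W v)"
    by (rule bij_betw_same_card)
  also have "\<dots> = (\<Sum>v \<in> - {0}. card (W v))" by (simp add: card_SigmaI)
  also have "\<dots> = card (- {0 :: 'a ^ 2}) * (CARD('a)\<^sup>2 - CARD('a))"
    using cardW by simp
  also have "card (- {0 :: 'a ^ 2}) = CARD('a)\<^sup>2 - 1" by (simp add: Compl_eq_Diff_UNIV card_Diff_subset)
  finally show ?thesis .
qed

text \<open>With x deleted, the blocks through x partition the translate by x of the invertible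
  matrices into classes of size q - 1. Their number is thus the order of the general linear group
  divided by q - 1.\<close>

lemma card_matrix_lines_through:
  fixes x :: "'a::{field,finite} ^ 2 ^ 2"
  shows "card {b \<in> matrix_lines. x \<in> b} = CARD('a) * (CARD('a)\<^sup>2 - 1)"
proof -
  let ?q = "CARD('a)" and ?T = "{b \<in> matrix_lines. x \<in> b}"
  let ?C = "(\<lambda>b. b - {x}) ` ?T"
  have q: "?q > 1" by (rule CARD_gt_1)
  \<comment> \<open>All these blocks contain x, so deleting it loses no information.\<close>
  have inj: "inj_on (\<lambda>b. b - {x}) ?T" by (auto simp: inj_on_def)
  have un: "\<Union>?C = (\<lambda>M. x + M) ` {M. det M \<noteq> 0}"
  proof (intro set_eqI iffI)
    fix y assume "y \<in> \<Union>?C"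
    then obtain b where b: "b \<in> matrix_lines" "x \<in> b" "y \<in> b" "x \<noteq> y" by blast
    then have "det (y - x) \<noteq> 0" using matrix_lines_through_two[OF b(4)] by blast
    then show "y \<in> (\<lambda>M. x + M) ` {M. det M \<noteq> 0}"
      by (intro image_eqI[of _ _ "y - x"]) auto
  next
    fix y assume "y \<in> (\<lambda>M. x + M) ` {M. det M \<noteq> 0}"
    then have d: "det (y - x) \<noteq> 0" by auto
    then have ne: "x \<noteq> y" by (auto simp: det_2)
    then show "y \<in> \<Union>?C"
      using d matrix_lines_through_two[OF ne, of "matrix_line x (y - x)"] by auto
  qed
  have "(?q - 1) * card ?C = card (\<Union>?C)"
  proof (rule card_partition)
    fix c assume "c \<in> ?C"
    then obtain N M where "c = matrix_line N M - {x}" "x \<in> matrix_line N M" "det M \<noteq> 0"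
      by (auto simp: matrix_lines_def)
    then show "card c = ?q - 1" by (simp add: card_matrix_line)
  next
    fix c d assume "c \<in> ?C" "d \<in> ?C" "c \<noteq> d"
    obtain b where b: "b \<in> matrix_lines" "x \<in> b" "c = b - {x}" using \<open>c \<in> ?C\<close> by auto
    obtain b' where b': "b' \<in> matrix_lines" "x \<in> b'" "d = b' - {x}" using \<open>d \<in> ?C\<close> by auto
    have False if y: "y \<in> c" "y \<in> d" for y
    proof -
      have "x \<noteq> y" using y b by blast
      from matrix_lines_through_two[OF this] have "b = matrix_line x (y - x)" "b' = matrix_line x (y - x)"
        using y b b' by (metis DiffD1)+
      then show False using b(3) b'(3) \<open>c \<noteq> d\<close> by simp
    qed
    then show "c \<inter> d = {}" by blast
  qed simp_all
  also have "card (\<Union>?C) = card {M :: 'a ^ 2 ^ 2. det M \<noteq> 0}"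
    unfolding un by (rule card_image) simp
  also have "\<dots> = (?q - 1) * (?q * (?q\<^sup>2 - 1))"
    unfolding card_det_nonzero by (simp add: power2_eq_square algebra_simps)
  finally have "card ?C = ?q * (?q\<^sup>2 - 1)" using q by simp
  then show ?thesis using inj by (simp add: card_image)
qed

section \<open>Realizing the three values\<close>

text \<open>Squaring identifies 1 and -1, which differ here; a map of a finite set to itself that is
  not injective is not surjective.\<close>

lemma exists_nonsquare:
  assumes "(2 :: 'a::{field,finite}) \<noteq> 0"
  shows "\<exists>r :: 'a. \<forall>a. a\<^sup>2 \<noteq> r"
proof (rule ccontr)
  assume "\<not> ?thesis"
  then have "surj (\<lambda>a :: 'a. a\<^sup>2)" by (metis surj_def)
  then have "inj (\<lambda>a :: 'a. a\<^sup>2)" by (rule finite_UNIV_surj_inj[OF finite])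
  then have "(1 :: 'a) = - 1" by (rule injD) simp
  then show False using assms by (simp add: eq_neg_iff_add_eq_0)
qed

text \<open>The point 0 and the direction I suffice: the points not joined to 0 then correspond to
  the eigenvalues of N, up to sign. It remains to find N with two, one or no eigenvalues in the
  field.\<close>

lemma exists_matrix_line_joined:
  assumes "(2 :: 'a::{field,finite}) \<noteq> 0" and k: "k \<in> {CARD('a) - 2, CARD('a) - 1, CARD('a)}"
  shows "\<exists>b \<in> matrix_lines. (0 :: 'a ^ 2 ^ 2) \<notin> b \<and> card {y \<in> b. joined matrix_lines 0 y} = k"
proof -
  let ?b = "\<lambda>N. matrix_line N (mat 1 :: 'a ^ 2 ^ 2)"
  have b: "?b N \<in> matrix_lines" for N
    unfolding matrix_lines_def by (intro CollectI exI[of _ N] exI[of _ "mat 1"]) simp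
  \<comment> \<open>The first condition says that N is not a scalar matrix, so the line through N
    with direction I misses 0.\<close>
  have wit: ?thesis if "(N $ 1 $ 2, N $ 2 $ 1, N $ 1 $ 1 - N $ 2 $ 2) \<noteq> (0, 0, 0)"
    and "k = CARD('a) - card {a. (N $ 1 $ 1 + a) * (N $ 2 $ 2 + a) = N $ 1 $ 2 * N $ 2 $ 1}"
    for N :: "'a ^ 2 ^ 2"
  proof -
    have "N + mat a \<noteq> 0" for a
      using that(1) by (auto simp: vec_eq_iff forall_2 mat_def add_eq_0_iff)
    then have "0 \<notin> ?b N" by (auto simp: matrix_line_def)
    moreover have "{a. det ((N - 0) + mat a ** mat 1) = 0}
        = {a. (N $ 1 $ 1 + a) * (N $ 2 $ 2 + a) = N $ 1 $ 2 * N $ 2 $ 1}"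
      unfolding matrix_mul_rid by (simp add: det_2 mat_def)
    ultimately show ?thesis
      using that(2) b[of N] card_joined_matrix_line[of "mat 1" 0 N] by (intro bexI[of _ "?b N"]) simp_all
  qed
  consider "k = CARD('a) - 2" | "k = CARD('a) - 1" | "k = CARD('a)" using k by blast
  then show ?thesis
  proof cases
    case 1
    have ne: "(1 :: 'a) \<noteq> - 1" using assms(1) by (simp add: eq_neg_iff_add_eq_0)
    \<comment> \<open>A diagonal matrix with the distinct eigenvalues 1 and -1. The next case uses a
      nilpotent matrix, whose only eigenvalue is 0.\<close>
    have "{a. (1 + a) * (- 1 + a) = 0} = {1, - 1 :: 'a}"
      by (auto simp: add_eq_0_iff)
    then show ?thesis
      using 1 ne by (intro wit[of "vector [vector [1, 0], vector [0, - 1]]"]) auto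
  next
    case 2
    then show ?thesis by (intro wit[of "vector [vector [0, 1], vector [0, 0]]"]) auto
  next
    case 3
    obtain r :: 'a where r: "\<And>a. a\<^sup>2 \<noteq> r" using exists_nonsquare[OF assms(1)] by blast
    \<comment> \<open>The witness has characteristic polynomial a^2 - r, which has no root.\<close>
    then have "{a. a * a = r} = {}" by (simp add: power2_eq_square)
    then show ?thesis
      using 3 by (intro wit[of "vector [vector [0, 1], vector [r, 0]]"]) auto
  qed
qed

section \<open>The axioms for lines of matrices\<close>

lemma generalized_partial_geometry_matrix_lines:
  assumes two: "(2 :: 'a::{field,finite}) \<noteq> 0" and q: "CARD('a) = q" "q \<ge> 3"
  shows "generalized_partial_geometry 3 (q - 1) (q * (q\<^sup>2 - 1) - 1) [q - 2, q - 1, q]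
    (UNIV :: ('a ^ 2 ^ 2) set) matrix_lines"
proof -
  \<comment> \<open>Positivity makes the truncated subtraction in t exact, so that t + 1 is the
    number of blocks through a point.\<close>
  have "q * (q\<^sup>2 - 1) > 0" using q(2) by (simp add: power2_eq_square one_less_mult)
  then have through: "card {b \<in> matrix_lines. x \<in> b} = q * (q\<^sup>2 - 1) - 1 + 1" for x :: "'a ^ 2 ^ 2"
    using card_matrix_lines_through[of x] q(1) by simp
  have one: "b = b'" if "b \<in> matrix_lines" "b' \<in> matrix_lines" "{x, y} \<subseteq> b" "{x, y} \<subseteq> b'" "x \<noteq> y"
    for b b' and x y :: "'a ^ 2 ^ 2"
    using that matrix_lines_through_two[of x y] by (metis insert_subset)
  have card: "card b = q - 1 + 1" if "b \<in> matrix_lines" for b :: "('a ^ 2 ^ 2) set"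
    using that q by (auto simp: matrix_lines_def card_matrix_line)
  have join: "card {y \<in> b. joined matrix_lines x y} \<in> {q - 2, q - 1, q}"
    if b: "b \<in> matrix_lines" and x: "x \<notin> b" for b and x :: "'a ^ 2 ^ 2"
  proof -
    obtain N M where NM: "b = matrix_line N M" "det M \<noteq> 0"
      using b by (auto simp: matrix_lines_def)
    define k where "k = card {a. det ((N - x) + mat a ** M) = 0}"
    have "k \<le> 2" unfolding k_def using NM(2) by (rule card_quadratic_roots)
    then have "k = 0 \<or> k = 1 \<or> k = 2" by linarith
    moreover have "card {y \<in> b. joined matrix_lines x y} = q - k"
      using card_joined_matrix_line[OF NM(2), of x N] x by (simp add: NM(1) q(1) k_def)
    ultimately show ?thesis by auto
  qed
  show ?thesis
    unfolding generalized_partial_geometry_def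
  proof (intro conjI)
    show "\<forall>x\<in>UNIV. \<forall>y\<in>UNIV. x \<noteq> y \<longrightarrow>
        (\<forall>b\<in>matrix_lines. \<forall>b'\<in>matrix_lines. {x, y :: 'a ^ 2 ^ 2} \<subseteq> b \<and> {x, y} \<subseteq> b' \<longrightarrow> b = b')"
      by (intro ballI impI, elim conjE) (rule one)
    show "\<forall>b\<in>matrix_lines :: ('a ^ 2 ^ 2) set set. card b = q - 1 + 1"
      using card by blast
    show "\<forall>x\<in>UNIV. card {b \<in> matrix_lines. (x :: 'a ^ 2 ^ 2) \<in> b} = q * (q\<^sup>2 - 1) - 1 + 1"
      using through by blast
    show "\<forall>x\<in>UNIV. \<forall>b\<in>matrix_lines. (x :: 'a ^ 2 ^ 2) \<notin> b \<longrightarrow>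
        card {y \<in> b. joined matrix_lines x y} \<in> set [q - 2, q - 1, q]"
      using join by simp
    show "\<forall>k\<in>set [q - 2, q - 1, q]. \<exists>x\<in>UNIV. \<exists>b\<in>matrix_lines. (x :: 'a ^ 2 ^ 2) \<notin> b \<and>
        card {y \<in> b. joined matrix_lines x y} = k"
      using exists_matrix_line_joined[OF two, unfolded q(1)]
      by (intro ballI, rule bexI[of _ 0]) simp_all
  qed (use q(2) in auto)
qed

section \<open>Blocks of quadrics as affine lines\<close>

text \<open>The matrix on the right is \<open>det B\<close> times \<open>J B\<^sup>-\<^sup>1\<close> with \<open>J = ((0, 1), (-1, 0))\<close>.\<close>

lemma skew_mult_iff_multiple:
  fixes B N :: "'a::field ^ 2 ^ 2"
  assumes two: "(2 :: 'a) \<noteq> 0" and B: "det B \<noteq> 0"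
  shows "transpose B ** transpose N + N ** B = 0 \<longleftrightarrow>
    (\<exists>a. N = mat a ** vector [vector [- B $ 2 $ 1, B $ 1 $ 1], vector [- B $ 2 $ 2, B $ 1 $ 2]])"
    (is "?S = 0 \<longleftrightarrow> (\<exists>a. N = mat a ** ?M)")
proof
  assume S: "?S = 0"
  \<comment> \<open>The hypothesis says that N B is skew, and \<open>s\<close> is its upper right
    entry. So N B = s J, which explains the parameter \<open>s / det B\<close> below.\<close>
  define s where "s = N $ 1 $ 1 * B $ 1 $ 2 + N $ 1 $ 2 * B $ 2 $ 2"
  have c: "?S $ i $ j = 0" for i j using S by simp
  have "2 * (N $ 1 $ 1 * B $ 1 $ 1 + N $ 1 $ 2 * B $ 2 $ 1) = 0"
    "2 * (N $ 2 $ 1 * B $ 1 $ 2 + N $ 2 $ 2 * B $ 2 $ 2) = 0"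
    using c[of 1 1] c[of 2 2]
    by (simp_all add: matrix_matrix_mult_def transpose_def sum_2 algebra_simps)
  \<comment> \<open>Cancelling 2 is what makes the diagonal of the skew matrix N B vanish.\<close>
  then have e: "N $ 1 $ 1 * B $ 1 $ 1 + N $ 1 $ 2 * B $ 2 $ 1 = 0"
    "N $ 2 $ 1 * B $ 1 $ 2 + N $ 2 $ 2 * B $ 2 $ 2 = 0"
    using two by (simp_all only: mult_eq_0_iff simp_thms)
  have e3: "N $ 2 $ 1 * B $ 1 $ 1 + N $ 2 $ 2 * B $ 2 $ 1 = - s"
    using c[of 1 2]
    by (simp add: s_def matrix_matrix_mult_def transpose_def sum_2 eq_neg_iff_add_eq_0 algebra_simps)
  \<comment> \<open>Multiplication of N B = s J on the right by the adjugate of B.\<close>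
  have "N $ 1 $ 1 * det B = - s * B $ 2 $ 1" "N $ 1 $ 2 * det B = s * B $ 1 $ 1"
    "N $ 2 $ 1 * det B = - s * B $ 2 $ 2" "N $ 2 $ 2 * det B = s * B $ 1 $ 2"
    using e e3 unfolding det_2 s_def by algebra+
  then have "N = mat (s / det B) ** ?M"
    using B by (simp add: vec_eq_iff forall_2 mat_mult_nth field_simps)
  then show "\<exists>a. N = mat a ** ?M" by blast
next
  assume "\<exists>a. N = mat a ** ?M"
  then obtain a where "N = mat a ** ?M" ..
  then have "N $ 1 $ 1 = - (a * B $ 2 $ 1)" "N $ 1 $ 2 = a * B $ 1 $ 1"
    "N $ 2 $ 1 = - (a * B $ 2 $ 2)" "N $ 2 $ 2 = a * B $ 1 $ 2"
    by (simp_all add: mat_mult_nth)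
  then show "?S = 0"
    by (simp add: vec_eq_iff forall_2 matrix_matrix_mult_def transpose_def sum_2 algebra_simps)
qed

text \<open>The equation is affine in N, so subtracting the particular solution \<open>N0\<close>
  reduces it to the homogeneous equation.\<close>

lemma solutions_eq_matrix_line:
  fixes B N :: "'a::field ^ 2 ^ 2"
  assumes two: "(2 :: 'a) \<noteq> 0" and B: "det B \<noteq> 0"
    and N0: "transpose B ** transpose N0 + N0 ** B + C = 0"
  shows "{N. transpose B ** transpose N + N ** B + C = 0} =
    matrix_line N0 (vector [vector [- B $ 2 $ 1, B $ 1 $ 1], vector [- B $ 2 $ 2, B $ 1 $ 2]])"
    (is "_ = matrix_line N0 ?M")
proof -
  have "transpose B ** transpose N + N ** B + C = 0 \<longleftrightarrow> N \<in> matrix_line N0 ?M" for N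
  proof -
    have "transpose B ** transpose (N - N0) + (N - N0) ** B =
      (transpose B ** transpose N + N ** B + C) - (transpose B ** transpose N0 + N0 ** B + C)"
      by (simp add: vec_eq_iff forall_2 matrix_matrix_mult_def transpose_def sum_2 algebra_simps)
    then have "transpose B ** transpose N + N ** B + C = 0 \<longleftrightarrow>
      transpose B ** transpose (N - N0) + (N - N0) ** B = 0"
      using N0 by simp
    also have "\<dots> \<longleftrightarrow> N \<in> matrix_line N0 ?M"
      unfolding skew_mult_iff_multiple[OF two B] matrix_line_def by (auto simp: algebra_simps)
    finally show ?thesis .
  qed
  then show ?thesis by blast
qed

lemma blocks1_eq_image_matrix_lines:
  assumes two: "(2 :: 'a::field) \<noteq> 0"
  shows "(blocks1 :: ('a ^ 4) set set set) =
    (`) (\<lambda>N. row_span (row_block N (mat 1))) ` matrix_lines"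
proof -
  have "{{N. transpose B ** transpose N + N ** B + C = 0} | B C.
      invertible B \<and> transpose C = C} = (matrix_lines :: ('a ^ 2 ^ 2) set set)" (is "?L = _")
  proof (intro equalityI subsetI)
    fix b assume "b \<in> ?L"
    then obtain B C :: "'a ^ 2 ^ 2" where b: "b = {N. transpose B ** transpose N + N ** B + C = 0}"
      and B: "invertible B" and C: "transpose C = C" by blast
    have d: "det B \<noteq> 0" using B by (simp add: invertible_det_nz)
    obtain B' where B': "B' ** B = mat 1" using B by (auto simp: invertible_def)
    \<comment> \<open>A particular solution: N0 B = - C / 2 is symmetric, so adding its transpose to
      it gives - C.\<close>
    define N0 where "N0 = mat (- 1 / 2) ** C ** B'"
    have NB: "N0 ** B = mat (- 1 / 2) ** C"
      by (simp add: N0_def B' flip: matrix_mul_assoc)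
    have C': "C $ i $ j = C $ j $ i" for i j
      using arg_cong[OF C, of "\<lambda>M. M $ i $ j"] by (simp add: transpose_def)
    have "transpose (N0 ** B) + N0 ** B + C = 0"
      unfolding NB using two by (simp add: vec_eq_iff forall_2 mat_mult_nth transpose_def C'[of 2 1] field_simps)
    then have "transpose B ** transpose N0 + N0 ** B + C = 0"
      by (simp add: matrix_transpose_mul)
    note solutions_eq_matrix_line[OF two d this]
    moreover have "det (vector [vector [- B $ 2 $ 1, B $ 1 $ 1], vector [- B $ 2 $ 2, B $ 1 $ 2]]
        :: 'a ^ 2 ^ 2) \<noteq> 0"
      using d by (simp add: det_2 algebra_simps)
    ultimately show "b \<in> matrix_lines" unfolding b matrix_lines_def by blast
  next
    fix b :: "('a ^ 2 ^ 2) set" assume "b \<in> matrix_lines"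
    then obtain N0 M where b: "b = matrix_line N0 M" and M: "det M \<noteq> 0"
      by (auto simp: matrix_lines_def)
    \<comment> \<open>This is \<open>det M\<close> times the product of the inverse of M with J,
      chosen so that the direction built from \<open>B\<close> is M itself. Then \<open>C\<close> is
      forced by requiring that \<open>N0\<close> lie on the block; it is symmetric, being minus the
      sum of a matrix and its transpose.\<close>
    define B :: "'a ^ 2 ^ 2" where
      "B = vector [vector [M $ 1 $ 2, M $ 2 $ 2], vector [- M $ 1 $ 1, - M $ 2 $ 1]]"
    define C where "C = - (transpose B ** transpose N0 + N0 ** B)"
    have d: "det B \<noteq> 0" using M by (simp add: B_def det_2 algebra_simps)
    have "vector [vector [- B $ 2 $ 1, B $ 1 $ 1], vector [- B $ 2 $ 2, B $ 1 $ 2]] = M"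
      by (simp add: B_def vec_eq_iff forall_2)
    moreover have "transpose B ** transpose N0 + N0 ** B + C = 0" by (simp add: C_def)
    ultimately have "b = {N. transpose B ** transpose N + N ** B + C = 0}"
      using solutions_eq_matrix_line[OF two d, of N0 C] b by simp
    moreover have "transpose C = C"
      by (simp add: C_def vec_eq_iff forall_2 matrix_matrix_mult_def transpose_def sum_2 algebra_simps)
    ultimately show "b \<in> ?L" using d by (auto simp: invertible_det_nz)
  qed
  note lines = this[symmetric]
  have "(`) f ` {S B C | B C. R B C} = {f ` S B C | B C. R B C}"
    for f :: "'a ^ 2 ^ 2 \<Rightarrow> ('a ^ 4) set" and S and R :: "'a ^ 2 ^ 2 \<Rightarrow> 'a ^ 2 ^ 2 \<Rightarrow> bool"
    by blast
  then show ?thesis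
    unfolding blocks1_eq[OF two] lines setcompr_eq_image[where f = "\<lambda>N. row_span (row_block N (mat 1))"]
    by simp
qed

section \<open>Return to projective lines\<close>

lemma inj_row_span_row_block:
  "inj (\<lambda>N :: 'a::field ^ 2 ^ 2. row_span (row_block N (mat 1)))"
proof (rule injI)
  fix N N' :: "'a ^ 2 ^ 2"
  assume eq: "row_span (row_block N (mat 1)) = row_span (row_block N' (mat 1))"
  \<comment> \<open>These are the rows of (N I). In the row space of (N' I) the last two coordinates
    determine a vector, so they are the rows of (N' I) as well.\<close>
  have "vector [N $ 1 $ 1, N $ 1 $ 2, 1, 0] \<in> row_span (row_block N (mat 1))"
    "vector [N $ 2 $ 1, N $ 2 $ 2, 0, 1] \<in> row_span (row_block N (mat 1))"
    by (simp_all add: mem_row_span_lines1)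
  then show "N = N'"
    unfolding eq by (simp add: mem_row_span_lines1 vec_eq_iff forall_2)
qed

theorem theorem3p14:
  fixes q :: nat
  assumes "CARD('a::{field,finite}) = q" and "odd q"
  shows "generalized_partial_geometry 3 (q - 1) (q * (q^2 - 1) - 1) [q - 2, q - 1, q]
           (lines1 :: ('a ^ 4) set set) blocks1"
proof -
  have two: "(2 :: 'a) \<noteq> 0"
    using assms by (intro two_neq_zero_if_odd_CARD) simp
  have "q > 1" using CARD_gt_1[where 'a='a] assms(1) by simp
  then have "q \<ge> 3" using assms(2) by (cases "q = 2") auto
  then show ?thesis
    unfolding lines1_eq blocks1_eq_image_matrix_lines[OF two]
    by (intro generalized_partial_geometry_image inj_row_span_row_block
        generalized_partial_geometry_matrix_lines[OF two assms(1)])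
qed

end
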